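(* Let $\mathcal{O}\subset\mathbb{R}^d$ be an open subset, $\mathfrak{K}\subset W^{2,d}_{\mathrm{loc}}(\mathcal{O})$ a convex cone, and $\Sigma\subseteq\partial\mathcal{O}$ a relatively open subset. Let $Au=-\operatorname{tr}(aD^2u)-\langle b,Du\rangle+cu$ and suppose that, for every open subset $\mathcal{U}\subset\mathcal{O}$, $A$ has the weak maximum principle property on $\mathcal{U}\cup\Sigma$ for the cone $\mathfrak{K}$. Let $f\in L^d_{\mathrm{loc}}(\mathcal{O})$ and $\psi\in L^d_{\mathrm{loc}}(\mathcal{O})$. Suppose $u\in\mathfrak{K}$ (respectively, $v\in-\mathfrak{K}$) is a solution (respectively, supersolution) to the obstacle problem, $$\min\{Au-f,\,u-\psi\}=0\quad\text{a.e. on }\mathcal{O}\qquad(\text{respectively, }\min\{Av-f,\,v-\psi\}\ge 0\ \text{a.e. on }\mathcal{O}).$$ If $v_*\ge u^*$ on $\partial\mathcal{O}\setminus\bar\Sigma$, then $v\ge u$ on $\mathcal{O}$; if $u,v$ are solutions and $v_*=u^*$ on $\partial\mathcal{O}\setminus\bar\Sigma$, then $u=v$ on $\mathcal{O}$.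
   Context: $a:\mathcal{O}\to\mathscr{S}^+(d)$ (non-negative definite symmetric real $d\times d$ matrices), $b:\mathcal{O}\to\mathbb{R}^d$, $c:\mathcal{O}\to\mathbb{R}$ are measurable. $u^*$ and $u_*$ denote the upper and lower semicontinuous envelopes of $u$ on the closure of its domain. Weak maximum principle property on $\mathcal{U}\cup\Sigma$ for $\mathfrak{K}$ ($\mathcal{U}\subset\mathcal{O}$ open; $\Sigma$ is read as $\Sigma\cap\partial\mathcal{U}$, and functions in $\mathfrak{K}$ are restricted to $\mathcal{U}$): whenever $u\in\mathfrak{K}$ obeys $Au\le 0$ a.e. on $\mathcal{U}$ and $u^*\le 0$ on $\partial\mathcal{U}\setminus\bar\Sigma$, where $u^*$ is the envelope of $u|_{\mathcal{U}}$ on $\bar{\mathcal{U}}$, then $u\le 0$ on $\mathcal{U}$.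
   Formalization: Uniqueness also assumes u,v in both K and -K, and u_*=v^* with u^* finite on ∂O∖Σ̄; comparison excludes u^*=v_*=±∞ there; the weak maximum principle on U requires u^*≤0 only off the closure of all of Σ, not of Σ∩∂U. Without these the claims fail. *)

theory Defs
  imports "HOL-Analysis.Analysis"
begin

definition partial_deriv :: "'n::finite \<Rightarrow> (real^'n \<Rightarrow> real) \<Rightarrow> real^'n \<Rightarrow> real" where
  "partial_deriv i f x = frechet_derivative f (at x) (axis i 1)"

primrec Ck :: "nat \<Rightarrow> (real^'n::finite \<Rightarrow> real) \<Rightarrow> bool" where
  "Ck 0 f \<longleftrightarrow> continuous_on UNIV f"
| "Ck (Suc k) f \<longleftrightarrow> f differentiable_on UNIV \<and> (\<forall>i. Ck k (partial_deriv i f))"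

definition test_functions :: "(real^'n::finite) set \<Rightarrow> (real^'n \<Rightarrow> real) set" where
  "test_functions \<Omega> = {\<phi>. (\<forall>k. Ck k \<phi>) \<and>
     compact (closure {x. \<phi> x \<noteq> 0}) \<and> closure {x. \<phi> x \<noteq> 0} \<subseteq> \<Omega>}"

text \<open>
  Functions on \<open>\<Omega>\<close> are represented by total functions; their values outside \<open>\<Omega>\<close> are irrelevant in
  all notions below. Elements of the \<open>Lp_loc\<close> and \<open>W2p_loc\<close> spaces are functions, not
  equivalence classes modulo null sets.
\<close>

definition Lp_loc :: "nat \<Rightarrow> (real^'n::finite) set \<Rightarrow> (real^'n \<Rightarrow> real) set" where
  "Lp_loc p \<Omega> = {g. g \<in> borel_measurable (lebesgue_on \<Omega>) \<and>
     (\<forall>C. compact C \<and> C \<subseteq> \<Omega> \<longrightarrow> integrable (lebesgue_on C) (\<lambda>x. \<bar>g x\<bar> ^ p))}"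

definition has_weak_partial ::
    "(real^'n::finite) set \<Rightarrow> 'n \<Rightarrow> (real^'n \<Rightarrow> real) \<Rightarrow> (real^'n \<Rightarrow> real) \<Rightarrow> bool" where
  "has_weak_partial \<Omega> i u g \<longleftrightarrow> u \<in> Lp_loc 1 \<Omega> \<and> g \<in> Lp_loc 1 \<Omega> \<and>
     (\<forall>\<phi>\<in>test_functions \<Omega>.
        (\<integral>x. u x * partial_deriv i \<phi> x \<partial>lebesgue_on \<Omega>) = - (\<integral>x. g x * \<phi> x \<partial>lebesgue_on \<Omega>))"

definition W2p_loc :: "nat \<Rightarrow> (real^'n::finite) set \<Rightarrow> (real^'n \<Rightarrow> real) set" where
  "W2p_loc p \<Omega> = {u \<in> Lp_loc p \<Omega>. \<forall>i. \<exists>g\<in>Lp_loc p \<Omega>. has_weak_partial \<Omega> i u g \<and>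
     (\<forall>j. \<exists>h\<in>Lp_loc p \<Omega>. has_weak_partial \<Omega> j g h)}"

text \<open>
  A weak derivative is determined only almost everywhere; an arbitrary version is chosen, and it
  is used only in statements that hold almost everywhere.
\<close>

definition weak_partial :: "(real^'n::finite) set \<Rightarrow> 'n \<Rightarrow> (real^'n \<Rightarrow> real) \<Rightarrow> real^'n \<Rightarrow> real" where
  "weak_partial \<Omega> i u = (SOME g. has_weak_partial \<Omega> i u g)"

definition weak_gradient :: "(real^'n::finite) set \<Rightarrow> (real^'n \<Rightarrow> real) \<Rightarrow> real^'n \<Rightarrow> real^'n" where
  "weak_gradient \<Omega> u x = (\<chi> i. weak_partial \<Omega> i u x)"

definition weak_hessian :: "(real^'n::finite) set \<Rightarrow> (real^'n \<Rightarrow> real) \<Rightarrow> real^'n \<Rightarrow> real^'n^'n" where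
  "weak_hessian \<Omega> u x = (\<chi> i j. weak_partial \<Omega> j (weak_partial \<Omega> i u) x)"

definition elliptic_op ::
    "(real^'n::finite) set \<Rightarrow> (real^'n \<Rightarrow> real^'n^'n) \<Rightarrow> (real^'n \<Rightarrow> real^'n) \<Rightarrow> (real^'n \<Rightarrow> real) \<Rightarrow>
     (real^'n \<Rightarrow> real) \<Rightarrow> real^'n \<Rightarrow> real" where
  "elliptic_op \<Omega> a b c u x =
     - trace (a x ** weak_hessian \<Omega> u x) - b x \<bullet> weak_gradient \<Omega> u x + c x * u x"

definition nonneg_definite :: "real^'n^'n::finite \<Rightarrow> bool" where
  "nonneg_definite M \<longleftrightarrow> transpose M = M \<and> (\<forall>\<xi>. 0 \<le> \<xi> \<bullet> (M *v \<xi>))"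

text \<open>Semicontinuous envelopes of the restriction \<open>u|D\<close>, to be evaluated on \<open>closure D\<close>.\<close>

definition usc_env :: "'a::metric_space set \<Rightarrow> ('a \<Rightarrow> real) \<Rightarrow> 'a \<Rightarrow> ereal" where
  "usc_env D u x = (INF r\<in>{0<..}. SUP y\<in>D \<inter> ball x r. ereal (u y))"

definition lsc_env :: "'a::metric_space set \<Rightarrow> ('a \<Rightarrow> real) \<Rightarrow> 'a \<Rightarrow> ereal" where
  "lsc_env D u x = (SUP r\<in>{0<..}. INF y\<in>D \<inter> ball x r. ereal (u y))"

text \<open>
  Closure under combinations with strictly positive coefficients; the zero function is not
  required to belong to the cone.
\<close>

definition fun_convex_cone :: "('a \<Rightarrow> real) set \<Rightarrow> bool" where
  "fun_convex_cone K \<longleftrightarrow> (\<forall>u\<in>K. \<forall>v\<in>K. \<forall>s>0. \<forall>t>0. (\<lambda>x. s * u x + t * v x) \<in> K)"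

text \<open>
  Weak maximum principle property on \<open>U \<union> \<Sigma>\<close>, where \<open>U \<subseteq> \<Omega>\<close> is open and \<open>\<Sigma> \<subseteq> frontier \<Omega>\<close>. The part
  of \<open>frontier U\<close> without boundary condition is \<open>closure \<Sigma> \<inter> frontier U\<close>, which may be strictly
  larger than \<open>closure (\<Sigma> \<inter> frontier U)\<close>: with the latter, a subdomain touching \<open>closure \<Sigma>\<close> only at
  an endpoint of \<open>\<Sigma>\<close> would carry an additional boundary condition there, and comparison for
  obstacle problems would fail. Weak derivatives on \<open>\<Omega>\<close> restrict to weak derivatives
  on \<open>U\<close>, hence the operator is that of \<open>\<Omega>\<close>.
\<close>

definition weak_max_principle ::
    "(real^'n::finite) set \<Rightarrow> (real^'n \<Rightarrow> real^'n^'n) \<Rightarrow> (real^'n \<Rightarrow> real^'n) \<Rightarrow> (real^'n \<Rightarrow> real) \<Rightarrow>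
     (real^'n) set \<Rightarrow> (real^'n \<Rightarrow> real) set \<Rightarrow> (real^'n) set \<Rightarrow> bool" where
  "weak_max_principle \<Omega> a b c \<Sigma> K U \<longleftrightarrow>
     (\<forall>u\<in>K. (AE x in lebesgue_on U. elliptic_op \<Omega> a b c u x \<le> 0) \<and>
             (\<forall>x\<in>frontier U - closure \<Sigma>. usc_env U u x \<le> 0) \<longrightarrow>
             (\<forall>x\<in>U. u x \<le> 0))"

definition obstacle_solution ::
    "(real^'n::finite) set \<Rightarrow> (real^'n \<Rightarrow> real^'n^'n) \<Rightarrow> (real^'n \<Rightarrow> real^'n) \<Rightarrow> (real^'n \<Rightarrow> real) \<Rightarrow>
     (real^'n \<Rightarrow> real) \<Rightarrow> (real^'n \<Rightarrow> real) \<Rightarrow> (real^'n \<Rightarrow> real) \<Rightarrow> bool" where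
  "obstacle_solution \<Omega> a b c f \<psi> u \<longleftrightarrow>
     (AE x in lebesgue_on \<Omega>. min (elliptic_op \<Omega> a b c u x - f x) (u x - \<psi> x) = 0)"

definition obstacle_supersolution ::
    "(real^'n::finite) set \<Rightarrow> (real^'n \<Rightarrow> real^'n^'n) \<Rightarrow> (real^'n \<Rightarrow> real^'n) \<Rightarrow> (real^'n \<Rightarrow> real) \<Rightarrow>
     (real^'n \<Rightarrow> real) \<Rightarrow> (real^'n \<Rightarrow> real) \<Rightarrow> (real^'n \<Rightarrow> real) \<Rightarrow> bool" where
  "obstacle_supersolution \<Omega> a b c f \<psi> v \<longleftrightarrow>
     (AE x in lebesgue_on \<Omega>. min (elliptic_op \<Omega> a b c v x - f x) (v x - \<psi> x) \<ge> 0)"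

end

theory Submission
  imports Defs
begin

text \<open>
  Suppose \<open>u\<close> exceeds \<open>v\<close> somewhere and let \<open>U = {x \<in> \<Omega>. v x < u x}\<close>, which is open because \<open>u\<close> and
  \<open>v\<close> are continuous. On \<open>U\<close> the solution satisfies \<open>u > v \<ge> \<psi>\<close> almost everywhere, so the obstacle
  is not active and \<open>A u = f\<close>, whereas \<open>A v \<ge> f\<close>. Hence \<open>w = u - v\<close>, which belongs to the cone,
  satisfies \<open>A w \<le> 0\<close> on \<open>U\<close>. On the part of \<open>frontier U\<close> away from \<open>closure \<Sigma>\<close> the upper envelope of
  \<open>w\<close> is nonpositive: at points of \<open>\<Omega>\<close> because \<open>u \<le> v\<close> there and both are continuous, at points of
  \<open>frontier \<Omega>\<close> by the assumed inequality of the envelopes. The weak maximum principle on \<open>U\<close> yields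
  \<open>w \<le> 0\<close> on \<open>U\<close>, which is absurd. This is \<open>obstacle_comparison\<close>; the boundary estimate is
  \<open>usc_env_diff_le_0\<close>. Equality of two solutions follows by exchanging their roles.

  The step that takes work is \<open>A w = A u - A v\<close> almost everywhere. The operator is evaluated at
  arbitrarily chosen weak derivatives, and the choices for \<open>u\<close>, \<open>v\<close> and \<open>w\<close> are unrelated, so
  linearity amounts to uniqueness of weak derivatives up to null sets, that is, to the fundamental
  lemma of the calculus of variations \<open>AE_eq_0_if_weakly_zero\<close>: a locally integrable function \<open>g\<close> with
  \<open>\<integral> g \<phi> = 0\<close> for all test functions \<open>\<phi>\<close> vanishes almost everywhere. It is proved with the bumps
  that are products over all coordinates of \<open>exp (- \<epsilon> / (x\<^sub>i - p\<^sub>i)) * exp (- \<epsilon> / (q\<^sub>i - x\<^sub>i))\<close> inside the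
  box with corners \<open>p\<close> and \<open>q\<close>. They are smooth and converge to the indicator function of the box as
  \<open>\<epsilon>\<close> tends to \<open>0\<close>, so \<open>g\<close> has integral zero over every box with closure in \<open>\<Omega>\<close>; since boxes generate
  the Borel sets, \<open>g\<close> vanishes almost everywhere.
\<close>

section \<open>Smooth bumps supported in a box\<close>

lemma partial_deriv_eq:
  assumes "(f has_derivative f') (at x)"
  shows "partial_deriv i f x = f' (axis i 1)"
  unfolding partial_deriv_def using frechet_derivative_at[OF assms] by simp

text \<open>
  The recursion in \<open>Ck\<close> runs through \<open>partial_deriv\<close>, that is, through \<open>frechet_derivative\<close>, which is
  a choice. This rule lets smoothness be shown by exhibiting derivatives instead.
\<close>

lemma Ck_SucI:
  assumes "\<And>x. (f has_derivative f' x) (at x)" and "\<And>i. Ck k (\<lambda>x. f' x (axis i 1))"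
  shows "Ck (Suc k) f"
proof -
  have "partial_deriv i f = (\<lambda>x. f' x (axis i 1))" for i
    by (intro ext partial_deriv_eq assms)
  moreover have "f differentiable_on UNIV"
    using assms(1) by (auto simp: differentiable_on_def differentiable_def)
  ultimately show ?thesis using assms(2) by simp
qed

lemma Ck_SucD:
  assumes "Ck (Suc k) f"
  shows "(f has_derivative frechet_derivative f (at x)) (at x)" and "Ck k (partial_deriv i f)"
  using assms by (auto simp: differentiable_on_def frechet_derivative_works)

lemma Ck_Suc_imp: "Ck (Suc k) f \<Longrightarrow> Ck k f"
proof (induction k arbitrary: f)
  case 0
  then show ?case by (simp add: differentiable_imp_continuous_on)
next
  case (Suc k)
  then show ?case by (metis Ck.simps(2))
qed

lemma Ck_const: "Ck k (\<lambda>x. c)"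
proof (induction k arbitrary: c)
  case (Suc k)
  show ?case by (rule Ck_SucI[where f'="\<lambda>x h. 0"]) (auto intro: Suc)
qed simp

lemma Ck_add: "Ck k f \<Longrightarrow> Ck k g \<Longrightarrow> Ck k (\<lambda>x. f x + g x)"
proof (induction k arbitrary: f g)
  case 0
  then show ?case by (simp add: continuous_on_add)
next
  case (Suc k)
  show ?case
  proof (rule Ck_SucI)
    show "((\<lambda>x. f x + g x) has_derivative
        (\<lambda>h. frechet_derivative f (at x) h + frechet_derivative g (at x) h)) (at x)" for x
      using Suc.prems[THEN Ck_SucD(1)] by (intro has_derivative_add)
    show "Ck k (\<lambda>x. frechet_derivative f (at x) (axis i 1) + frechet_derivative g (at x) (axis i 1))" for i
      using Suc.IH[OF Suc.prems[THEN Ck_SucD(2)]] by (simp add: partial_deriv_def[abs_def])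
  qed
qed

lemma Ck_mult: "Ck k f \<Longrightarrow> Ck k g \<Longrightarrow> Ck k (\<lambda>x. f x * g x)"
proof (induction k arbitrary: f g)
  case 0
  then show ?case by (simp add: continuous_on_mult)
next
  case (Suc k)
  show ?case
  proof (rule Ck_SucI)
    show "((\<lambda>x. f x * g x) has_derivative
        (\<lambda>h. f x * frechet_derivative g (at x) h + frechet_derivative f (at x) h * g x)) (at x)" for x
      using Suc.prems[THEN Ck_SucD(1)] by (intro has_derivative_mult)
    show "Ck k (\<lambda>x. f x * frechet_derivative g (at x) (axis i 1)
        + frechet_derivative f (at x) (axis i 1) * g x)" for i
      using Ck_add[OF Suc.IH[OF Ck_Suc_imp[OF Suc.prems(1)] Ck_SucD(2)[OF Suc.prems(2), of i]]
          Suc.IH[OF Ck_SucD(2)[OF Suc.prems(1), of i] Ck_Suc_imp[OF Suc.prems(2)]]]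
      by (simp add: partial_deriv_def[abs_def])
  qed
qed

lemma Ck_prod: "(\<And>i. i \<in> I \<Longrightarrow> Ck k (f i)) \<Longrightarrow> Ck k (\<lambda>x. \<Prod>i\<in>I. f i x)"
  by (induction I rule: infinite_finite_induct) (auto intro: Ck_const Ck_mult)

text \<open>
  The functions \<open>exp (- \<epsilon> / t) / t ^ m\<close>, extended by zero to \<open>t \<le> 0\<close>. The exponent \<open>m\<close> is carried along
  because the derivative of such a function is a linear combination of the ones with exponents
  \<open>m + 1\<close> and \<open>m + 2\<close>, so that the whole family is smooth by one induction. Only \<open>m = 0\<close> is used
  to build bumps.
\<close>

definition flat_exp :: "real \<Rightarrow> nat \<Rightarrow> real \<Rightarrow> real" where
  "flat_exp \<epsilon> m t = (if t > 0 then exp (- (\<epsilon> / t)) / t ^ m else 0)"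

text \<open>
  In terms of \<open>s = 1 / t\<close> this is the decay of \<open>s ^ m / exp (\<epsilon> * s)\<close> at infinity.
\<close>

lemma flat_exp_tendsto_0:
  assumes "\<epsilon> > 0"
  shows "(flat_exp \<epsilon> m \<longlongrightarrow> 0) (at 0)"
proof -
  have lim: "((\<lambda>s. (\<epsilon> * s) ^ m / exp (\<epsilon> * s) / \<epsilon> ^ m) \<longlongrightarrow> 0 / \<epsilon> ^ m) at_top"
    using assms
    by (intro tendsto_divide tendsto_const filterlim_compose[OF tendsto_power_div_exp_0]
        filterlim_tendsto_pos_mult_at_top[OF tendsto_const _ filterlim_ident]) auto
  have "((\<lambda>s. flat_exp \<epsilon> m (inverse s)) \<longlongrightarrow> 0) at_top"
  proof (rule Lim_transform_eventually)
    show "((\<lambda>s. (\<epsilon> * s) ^ m / exp (\<epsilon> * s) / \<epsilon> ^ m) \<longlongrightarrow> 0) at_top" using lim by simp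
    show "\<forall>\<^sub>F s in at_top. (\<epsilon> * s) ^ m / exp (\<epsilon> * s) / \<epsilon> ^ m = flat_exp \<epsilon> m (inverse s)"
      using eventually_gt_at_top[of 0] by eventually_elim
        (use assms in \<open>simp add: flat_exp_def field_simps exp_minus power_mult_distrib power_inverse\<close>)
  qed
  then have right: "(flat_exp \<epsilon> m \<longlongrightarrow> 0) (at_right 0)"
    by (simp add: filterlim_at_right_to_top)
  have left: "(flat_exp \<epsilon> m \<longlongrightarrow> 0) (at_left 0)"
    by (rule Lim_transform_eventually[OF tendsto_const])
       (auto simp: flat_exp_def eventually_at_filter)
  show ?thesis using left right by (simp add: filterlim_at_split)
qed

lemma flat_exp_has_derivative:
  assumes "\<epsilon> > 0"
  shows "(flat_exp \<epsilon> m has_field_derivative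
    \<epsilon> * flat_exp \<epsilon> (m + 2) t - real m * flat_exp \<epsilon> (m + 1) t) (at t)"
proof -
  consider "t > 0" | "t < 0" | "t = 0" by linarith
  then show ?thesis
  proof cases
    case 1
    have "((\<lambda>t. exp (- (\<epsilon> / t)) / t ^ m) has_field_derivative
        \<epsilon> * flat_exp \<epsilon> (m + 2) t - real m * flat_exp \<epsilon> (m + 1) t) (at t)"
    proof -
      have "((\<lambda>t. t ^ m) has_field_derivative real m * t ^ m / t) (at t)"
        using DERIV_pow[of m t] 1 by (cases m) auto
      moreover have "((\<lambda>t. exp (- (\<epsilon> / t))) has_field_derivative \<epsilon> / t\<^sup>2 * exp (- (\<epsilon> / t))) (at t)"
        using 1 by (auto intro!: derivative_eq_intros simp: power2_eq_square)
      ultimately show ?thesis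
        using 1 by - (rule DERIV_cong[OF DERIV_divide],
          auto simp: flat_exp_def field_simps power2_eq_square)
    qed
    then show ?thesis
      by (rule has_field_derivative_transform_within_open[where S="{0<..}"])
         (use 1 in \<open>auto simp: flat_exp_def\<close>)
  next
    case 2
    have "((\<lambda>t. 0) has_field_derivative 0) (at t)" by simp
    then have "(flat_exp \<epsilon> m has_field_derivative 0) (at t)"
      by (rule has_field_derivative_transform_within_open[where S="{..<0}"])
         (use 2 in \<open>auto simp: flat_exp_def\<close>)
    then show ?thesis using 2 by (simp add: flat_exp_def)
  next
    case 3
    \<comment> \<open>The difference quotient at \<open>0\<close> is the member of the family with exponent \<open>m + 1\<close>.\<close>
    have "(\<lambda>h. (flat_exp \<epsilon> m (0 + h) - flat_exp \<epsilon> m 0) / h) = flat_exp \<epsilon> (m + 1)"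
      by (auto simp: flat_exp_def fun_eq_iff field_simps)
    then show ?thesis using flat_exp_tendsto_0[OF assms, of "m + 1"] 3
      by (simp add: DERIV_def flat_exp_def)
  qed
qed

lemma Ck_flat_exp:
  assumes "\<epsilon> > 0"
  shows "Ck k (\<lambda>x. flat_exp \<epsilon> m (s * x $ i + r))"
proof (induction k arbitrary: m)
  case 0
  have "isCont (flat_exp \<epsilon> m) t" for t
    using flat_exp_has_derivative[OF assms] DERIV_isCont by blast
  then have "continuous_on UNIV (flat_exp \<epsilon> m)"
    by (simp add: continuous_at_imp_continuous_on)
  then show ?case
    unfolding Ck.simps
    by (rule continuous_on_compose2[of UNIV "flat_exp \<epsilon> m"]) (auto intro!: continuous_intros)
next
  case (Suc k)
  let ?d = "\<lambda>x. \<epsilon> * flat_exp \<epsilon> (m + 2) (s * x $ i + r) + (- real m) * flat_exp \<epsilon> (m + 1) (s * x $ i + r)"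
  show ?case
  proof (rule Ck_SucI)
    show "((\<lambda>x. flat_exp \<epsilon> m (s * x $ i + r)) has_derivative (\<lambda>h. ?d x * (s * h $ i))) (at x)"
      for x :: "real^'a"
    proof -
      have "((\<lambda>x. s * x $ i + r) has_derivative (\<lambda>h. s * h $ i)) (at x)"
        using has_derivative_add[OF has_derivative_mult_right[OF bounded_linear_imp_has_derivative[OF
            bounded_linear_vec_nth]] has_derivative_const] by simp
      from has_derivative_compose[OF this
          flat_exp_has_derivative[OF assms, THEN has_field_derivative_imp_has_derivative]]
      show ?thesis by (simp add: mult.commute)
    qed
    show "Ck k (\<lambda>x. ?d x * (s * axis j 1 $ i))" for j
      by (intro Ck_mult Ck_add Ck_const Suc.IH)
  qed
qed

text \<open>
  A product of one-dimensional bumps, one for each face of the box. As \<open>\<epsilon>\<close> decreases to \<open>0\<close> it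
  increases to the indicator function of the open box, while its support stays in the closed box.
  This gives explicit smooth approximations of indicator functions without any mollification.
\<close>

definition box_bump :: "real \<Rightarrow> real^'n::finite \<Rightarrow> real^'n \<Rightarrow> real^'n \<Rightarrow> real" where
  "box_bump \<epsilon> p q x = (\<Prod>i\<in>UNIV. flat_exp \<epsilon> 0 (x $ i - p $ i) * flat_exp \<epsilon> 0 (q $ i - x $ i))"

lemma Ck_box_bump:
  assumes "\<epsilon> > 0" shows "Ck k (box_bump \<epsilon> p q)"
proof -
  have "Ck k (\<lambda>x. flat_exp \<epsilon> 0 (1 * x $ i + (- p $ i)) * flat_exp \<epsilon> 0 ((-1) * x $ i + q $ i))" for i
    by (intro Ck_mult Ck_flat_exp assms)
  then show ?thesis unfolding box_bump_def by (intro Ck_prod) simp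
qed

lemma box_bump_outside: "x \<notin> box p q \<Longrightarrow> box_bump \<epsilon> p q x = 0"
  unfolding box_bump_def by (rule prod_zero) (auto simp: mem_box_cart flat_exp_def)

lemma box_bump_bounds:
  assumes "\<epsilon> > 0" shows "0 \<le> box_bump \<epsilon> p q x" "box_bump \<epsilon> p q x \<le> 1"
proof -
  have "0 \<le> flat_exp \<epsilon> 0 t \<and> flat_exp \<epsilon> 0 t \<le> 1" for t
    using assms by (auto simp: flat_exp_def)
  then show "0 \<le> box_bump \<epsilon> p q x" "box_bump \<epsilon> p q x \<le> 1"
    unfolding box_bump_def by (auto intro!: prod_nonneg prod_le_1 mult_le_one)
qed

lemma box_bump_test_function:
  assumes "\<epsilon> > 0" "cbox p q \<subseteq> \<Omega>"
  shows "box_bump \<epsilon> p q \<in> test_functions \<Omega>"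
proof -
  have "{x. box_bump \<epsilon> p q x \<noteq> 0} \<subseteq> cbox p q"
    using box_bump_outside box_subset_cbox by fastforce
  then have sub: "closure {x. box_bump \<epsilon> p q x \<noteq> 0} \<subseteq> cbox p q"
    by (intro closure_minimal) auto
  then have "compact (closure {x. box_bump \<epsilon> p q x \<noteq> 0})"
    using bounded_subset[OF bounded_cbox sub] by (simp add: compact_eq_bounded_closed)
  then show ?thesis
    unfolding test_functions_def using sub assms Ck_box_bump by blast
qed

lemma box_bump_tendsto_indicator:
  "(\<lambda>n. box_bump (inverse (real (Suc n))) p q x) \<longlonglongrightarrow> indicator (box p q) x"
proof (cases "x \<in> box p q")
  case True
  have flat: "(\<lambda>n. flat_exp (inverse (real (Suc n))) 0 t) \<longlonglongrightarrow> 1" if "t > 0" for t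
  proof -
    have "(\<lambda>n. exp (- (inverse (real (Suc n)) / t))) \<longlonglongrightarrow> exp (- (0 / t))"
      by (intro tendsto_intros LIMSEQ_inverse_real_of_nat) (use that in auto)
    then show ?thesis using that by (simp add: flat_exp_def)
  qed
  have "(\<lambda>n. box_bump (inverse (real (Suc n))) p q x) \<longlonglongrightarrow> (\<Prod>i\<in>(UNIV::'a set). 1 * 1)"
    unfolding box_bump_def
    by (intro tendsto_prod tendsto_mult flat) (use True in \<open>auto simp: mem_box_cart\<close>)
  then show ?thesis using True by simp
qed (simp add: box_bump_outside)

section \<open>Weakly zero functions vanish almost everywhere\<close>

lemma Lp_loc_1_iff:
  "g \<in> Lp_loc 1 \<Omega> \<longleftrightarrow> g \<in> borel_measurable (lebesgue_on \<Omega>) \<and>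
     (\<forall>C. compact C \<and> C \<subseteq> \<Omega> \<longrightarrow> integrable (lebesgue_on C) g)"
proof -
  have "integrable (lebesgue_on C) (\<lambda>x. \<bar>g x\<bar> ^ 1) \<longleftrightarrow> integrable (lebesgue_on C) g"
    if "g \<in> borel_measurable (lebesgue_on \<Omega>)" "C \<subseteq> \<Omega>" for C
    using integrable_abs_iff[OF measurable_restrict_mono[OF that]] by simp
  then show ?thesis unfolding Lp_loc_def by auto
qed

lemma Lp_loc_1_lincomb:
  assumes "g \<in> Lp_loc 1 \<Omega>" "h \<in> Lp_loc 1 \<Omega>"
  shows "(\<lambda>x. s * g x + t * h x) \<in> Lp_loc 1 \<Omega>"
  using assms unfolding Lp_loc_1_iff by auto

text \<open>
  A continuous function with compact support \<open>C\<close> in \<open>\<Omega>\<close> is bounded, and \<open>g\<close> is integrable on \<open>C\<close>.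
  This makes the integrals in the definition of weak derivatives genuine, so that they are additive.
\<close>

lemma integrable_Lp_loc_1_mult:
  assumes g: "g \<in> Lp_loc 1 \<Omega>" and "open \<Omega>" and C: "compact C" "C \<subseteq> \<Omega>"
    and th: "continuous_on UNIV \<theta>" "\<And>x. x \<notin> C \<Longrightarrow> \<theta> x = 0"
  shows "integrable (lebesgue_on \<Omega>) (\<lambda>x. g x * \<theta> x)"
proof -
  have Cm: "C \<in> sets lebesgue" using C by (simp add: compact_imp_closed)
  have Om: "\<Omega> \<in> sets lebesgue" using \<open>open \<Omega>\<close> by simp
  have gC: "integrable (lebesgue_on C) g" using g C unfolding Lp_loc_1_iff by blast
  have "continuous_on C \<theta>" using th continuous_on_subset by blast
  then have "bounded (\<theta> ` C)" using C compact_continuous_image compact_imp_bounded by blast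
  then obtain B where B: "\<And>x. x \<in> C \<Longrightarrow> \<bar>\<theta> x\<bar> \<le> B"
    unfolding bounded_iff by auto
  have th_meas: "\<theta> \<in> borel_measurable (lebesgue_on C)"
    by (rule continuous_imp_measurable_on_sets_lebesgue[OF \<open>continuous_on C \<theta>\<close> Cm])
  have "integrable (lebesgue_on C) (\<lambda>x. g x * \<theta> x)"
  proof (rule Bochner_Integration.integrable_bound)
    show "integrable (lebesgue_on C) (\<lambda>x. B * g x)" using gC by simp
    show "(\<lambda>x. g x * \<theta> x) \<in> borel_measurable (lebesgue_on C)"
      using th_meas gC by auto
    show "AE x in lebesgue_on C. norm (g x * \<theta> x) \<le> norm (B * g x)"
    proof (rule AE_I2)
      fix x assume "x \<in> space (lebesgue_on C)"
      then have "\<bar>\<theta> x\<bar> \<le> \<bar>B\<bar>" using B[of x] by simp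
      then show "norm (g x * \<theta> x) \<le> norm (B * g x)"
        by (simp add: abs_mult mult.commute mult_right_mono)
    qed
  qed
  then have "integrable lebesgue (\<lambda>x. indicator C x *\<^sub>R (g x * \<theta> x))"
    using Cm by (subst (asm) integrable_restrict_space) auto
  also have "(\<lambda>x. indicator C x *\<^sub>R (g x * \<theta> x)) = (\<lambda>x. indicator \<Omega> x *\<^sub>R (g x * \<theta> x))"
    using th(2) C by (auto simp: fun_eq_iff indicator_def)
  finally show ?thesis using Om by (subst integrable_restrict_space) auto
qed

text \<open>
  Boxes form an intersection-stable generator of the Borel sets. The sets over which \<open>G\<close> has
  integral zero are closed under countable disjoint unions and, because the integral over the whole
  space vanishes, under complements. So they comprise all Borel sets, in particular the sets where
  \<open>G\<close> is positive or negative. The argument is carried out for a Borel version \<open>G'\<close> of \<open>G\<close>, since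
  boxes do not generate the Lebesgue sets.
\<close>

lemma AE_eq_0_if_integral_box_eq_0:
  fixes G :: "'a::euclidean_space \<Rightarrow> real"
  assumes G: "integrable lebesgue G" and box: "\<And>p q. (LINT x:box p q|lebesgue. G x) = 0"
    and UN: "integral\<^sup>L lebesgue G = 0"
  shows "AE x in lebesgue. G x = 0"
proof -
  obtain G' where G': "G' \<in> borel_measurable lborel" "AE x in lborel. G x = G' x"
    using completion_ex_borel_measurable_real[OF borel_measurable_integrable[OF G]] by auto
  have ae: "AE x in lebesgue. G x = G' x" using G'(2) by (rule AE_completion)
  have G'm: "G' \<in> borel_measurable lebesgue" using G'(1) by (rule measurable_completion)
  have Gm: "G \<in> borel_measurable lebesgue" using G by simp
  have "integrable lebesgue G'"
    using integrable_cong_AE[OF Gm G'm ae] G by simp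
  then have intG': "integrable lborel G'" using G' integrable_completion by blast
  have tr: "(LINT x:A|lborel. G' x) = (LINT x:A|lebesgue. G x)" if [measurable]: "A \<in> sets borel" for A
  proof -
    have "(LINT x:A|lborel. G' x) = (LINT x:A|lebesgue. G' x)"
      unfolding set_lebesgue_integral_def
      by (rule integral_completion[symmetric]) (use G'(1) in measurable)
    also have "\<dots> = (LINT x:A|lebesgue. G x)"
      unfolding set_lebesgue_integral_def
    proof (rule integral_cong_AE)
      have "A \<in> sets lebesgue" using that by simp
      then show "(\<lambda>x. indicator A x *\<^sub>R G' x) \<in> borel_measurable lebesgue"
        "(\<lambda>x. indicator A x *\<^sub>R G x) \<in> borel_measurable lebesgue"
        using G'm Gm by (auto intro!: borel_measurable_times borel_measurable_indicator)
      show "AE x in lebesgue. indicat_real A x *\<^sub>R G' x = indicat_real A x *\<^sub>R G x"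
        using ae by eventually_elim simp
    qed
    finally show ?thesis .
  qed
  have zero: "(LINT x:A|lborel. G' x) = 0" if "A \<in> sets borel" for A
  proof -
    let ?E = "range (\<lambda>(p, q). box p q :: 'a set)"
    have sig: "sigma_sets UNIV ?E = sets borel"
      unfolding borel_eq_box by simp
    have UN': "(LINT x:UNIV|lborel. G' x) = 0" using tr[of UNIV] UN by (simp add: set_lebesgue_integral_def)
    have si: "set_integrable lborel B G'" if "B \<in> sets borel" for B
      unfolding set_integrable_def using integrable_mult_indicator[OF _ intG'] that by simp
    have "Int_stable ?E" by (auto simp: Int_stable_def box_Int_box)
    moreover have "?E \<subseteq> Pow UNIV" by simp
    moreover have "A \<in> sigma_sets UNIV ?E" using that sig by simp
    ultimately show ?thesis
    proof (induction A rule: sigma_sets_induct_disjoint)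
      case (basic A)
      then obtain p q where "A = box p q" by auto
      then show ?case using box tr[of "box p q"] by simp
    next
      case empty
      show ?case by (simp add: set_lebesgue_integral_def)
    next
      case (compl A)
      have "A \<in> sets borel" using compl sig by simp
      then have "(LINT x:A \<union> (UNIV - A)|lborel. G' x)
          = (LINT x:A|lborel. G' x) + (LINT x:UNIV - A|lborel. G' x)"
        by (intro set_integral_Un si) auto
      then show ?case using compl UN' by simp
    next
      case (union A)
      have "A i \<in> sets borel" for i using union sig by auto
      then have "(LINT x:(\<Union>i. A i)|lborel. G' x) = (\<Sum>i. (LINT x:(A i)|lborel. G' x))"
        by (intro lebesgue_integral_countable_add si)
           (use union in \<open>auto simp: disjoint_family_on_def\<close>)
      then show ?case using union by simp
    qed
  qed
  have "AE x in lborel. G' x = 0"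
    by (rule density_unique_real[OF intG', of "\<lambda>x. 0"]) (auto simp: zero)
  then have "AE x in lebesgue. G' x = 0" by (rule AE_completion)
  with ae show ?thesis by eventually_elim simp
qed

text \<open>
  Dominated convergence along the bumps, which are test functions on \<open>\<Omega>\<close> as soon as the closed box
  lies in \<open>\<Omega>\<close>.
\<close>

lemma set_integral_box_eq_0_if_weakly_zero:
  assumes g: "g \<in> Lp_loc 1 \<Omega>" and "open \<Omega>"
    and zero: "\<And>\<phi>. \<phi> \<in> test_functions \<Omega> \<Longrightarrow> (\<integral>x. g x * \<phi> x \<partial>lebesgue_on \<Omega>) = 0"
    and sub: "cbox p q \<subseteq> \<Omega>"
  shows "integrable lebesgue (\<lambda>x. indicator (box p q) x * g x)"
    and "(LINT x:box p q|lebesgue. g x) = 0"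
proof -
  have Om: "\<Omega> \<in> sets lebesgue" using \<open>open \<Omega>\<close> by simp
  have bsub: "box p q \<subseteq> \<Omega>" using sub box_subset_cbox by blast
  have "integrable (lebesgue_on (cbox p q)) g"
    using g sub unfolding Lp_loc_1_iff by auto
  then have "integrable lebesgue (\<lambda>x. indicator (cbox p q) x *\<^sub>R g x)"
    by (subst (asm) integrable_restrict_space) auto
  then have "set_integrable lebesgue (cbox p q) g" unfolding set_integrable_def .
  then have "set_integrable lebesgue (box p q) g"
    by (rule set_integrable_subset) (auto simp: box_subset_cbox)
  then show int: "integrable lebesgue (\<lambda>x. indicator (box p q) x * g x)"
    unfolding set_integrable_def by simp
  have eq: "(\<lambda>x. indicator \<Omega> x *\<^sub>R (indicator (box p q) x * g x)) = (\<lambda>x. indicator (box p q) x * g x)"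
    using bsub by (auto simp: fun_eq_iff indicator_def)
  have intO: "integrable (lebesgue_on \<Omega>) (\<lambda>x. indicator (box p q) x * g x)"
    using int Om by (subst integrable_restrict_space) (simp_all only: eq, auto)
  let ?b = "\<lambda>n. box_bump (inverse (real (Suc n))) p q"
  have "(\<lambda>n. \<integral>x. g x * ?b n x \<partial>lebesgue_on \<Omega>) \<longlonglongrightarrow> (\<integral>x. indicator (box p q) x * g x \<partial>lebesgue_on \<Omega>)"
  proof (rule integral_dominated_convergence[where w="\<lambda>x. \<bar>indicator (box p q) x * g x\<bar>"])
    show "(\<lambda>x. indicator (box p q) x * g x) \<in> borel_measurable (lebesgue_on \<Omega>)"
      using intO by simp
    show "(\<lambda>x. g x * ?b n x) \<in> borel_measurable (lebesgue_on \<Omega>)" for n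
    proof (rule borel_measurable_times)
      show "g \<in> borel_measurable (lebesgue_on \<Omega>)" using g unfolding Lp_loc_1_iff by blast
      have "continuous_on \<Omega> (?b n)"
        using Ck_box_bump[of "inverse (real (Suc n))" 0 p q] continuous_on_subset by auto
      then show "?b n \<in> borel_measurable (lebesgue_on \<Omega>)"
        using Om by (rule continuous_imp_measurable_on_sets_lebesgue)
    qed
    show "integrable (lebesgue_on \<Omega>) (\<lambda>x. \<bar>indicator (box p q) x * g x\<bar>)"
      using intO by simp
    show "AE x in lebesgue_on \<Omega>. (\<lambda>n. g x * ?b n x) \<longlonglongrightarrow> indicator (box p q) x * g x"
      using tendsto_mult[OF tendsto_const box_bump_tendsto_indicator, of "g _"]
      by (intro AE_I2) (simp add: mult.commute)
    show "AE x in lebesgue_on \<Omega>. norm (g x * ?b n x) \<le> \<bar>indicator (box p q) x * g x\<bar>" for n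
    proof (rule AE_I2)
      fix x
      have "\<bar>?b n x\<bar> \<le> indicator (box p q) x"
        using box_bump_bounds[of "inverse (real (Suc n))" p q x]
        by (cases "x \<in> box p q") (auto simp: box_bump_outside)
      then have "\<bar>g x\<bar> * \<bar>?b n x\<bar> \<le> \<bar>g x\<bar> * indicator (box p q) x"
        by (intro mult_left_mono) auto
      then show "norm (g x * ?b n x) \<le> \<bar>indicator (box p q) x * g x\<bar>"
        by (simp add: abs_mult mult.commute)
    qed
  qed
  moreover have "(\<integral>x. g x * ?b n x \<partial>lebesgue_on \<Omega>) = 0" for n
    by (intro zero box_bump_test_function sub) simp
  ultimately have "(\<integral>x. indicator (box p q) x * g x \<partial>lebesgue_on \<Omega>) = 0"
    using LIMSEQ_unique[OF tendsto_const] by fastforce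
  then show "(LINT x:box p q|lebesgue. g x) = 0"
    using Om eq by (subst (asm) integral_restrict_space) (auto simp: set_lebesgue_integral_def)
qed

text \<open>
  The fundamental lemma of the calculus of variations. Since \<open>g\<close> is only locally integrable, it is
  first cut off to a box with closure in \<open>\<Omega>\<close>; a nonempty intersection of it with a
  further box is again such a box.
  Countably many of these boxes cover \<open>\<Omega>\<close>.
\<close>

lemma AE_eq_0_if_weakly_zero:
  assumes g: "g \<in> Lp_loc 1 \<Omega>" and "open \<Omega>"
    and zero: "\<And>\<phi>. \<phi> \<in> test_functions \<Omega> \<Longrightarrow> (\<integral>x. g x * \<phi> x \<partial>lebesgue_on \<Omega>) = 0"
  shows "AE x in lebesgue_on \<Omega>. g x = 0"
proof -
  have box0: "integrable lebesgue (\<lambda>x. indicator (box p q) x * g x)"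
    "(LINT x:box p q|lebesgue. g x) = 0" if "cbox p q \<subseteq> \<Omega>" for p q
    using set_integral_box_eq_0_if_weakly_zero[OF g \<open>open \<Omega>\<close> _ that] zero by auto
  have on_box: "AE x in lebesgue. x \<in> box p q \<longrightarrow> g x = 0" if sub: "cbox p q \<subseteq> \<Omega>" for p q
  proof -
    have "AE x in lebesgue. indicator (box p q) x * g x = 0"
    proof (rule AE_eq_0_if_integral_box_eq_0)
      show "integrable lebesgue (\<lambda>x. indicator (box p q) x * g x)" by (rule box0(1)[OF sub])
      show "(\<integral>x. indicator (box p q) x * g x \<partial>lebesgue) = 0"
        using box0(2)[OF sub] by (simp add: set_lebesgue_integral_def)
      fix r s
      obtain p' q' where pq': "box r s \<inter> box p q = box p' q'" using box_Int_box by blast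
      have "(LINT x:box r s|lebesgue. indicator (box p q) x * g x) = (LINT x:box p' q'|lebesgue. g x)"
        unfolding set_lebesgue_integral_def pq'[symmetric]
        by (simp add: indicator_inter_arith mult.assoc)
      also have "\<dots> = 0"
      proof (cases "box p' q' = {}")
        case False
        then have "cbox p' q' = closure (box r s \<inter> box p q)" by (simp add: pq' closure_box)
        also have "\<dots> \<subseteq> cbox p q" by (intro closure_minimal) (use box_subset_cbox in auto)
        finally show ?thesis using box0(2) sub by blast
      qed (simp add: set_lebesgue_integral_def)
      finally show "(LINT x:box r s|lebesgue. indicator (box p q) x * g x) = 0" .
    qed
    then show ?thesis by eventually_elim (simp add: indicator_def split: if_splits)
  qed
  obtain \<D> where \<D>: "countable \<D>" "\<And>X. X \<in> \<D> \<Longrightarrow> \<exists>p q. X = box p q \<and> cbox p q \<subseteq> \<Omega>" "\<Union>\<D> = \<Omega>"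
  proof -
    let ?F = "{X. \<exists>p q. X = box p q \<and> cbox p q \<subseteq> \<Omega>}"
    obtain \<D> where "\<D> \<subseteq> ?F" "countable \<D>" "\<Union>\<D> = \<Union>?F"
      by (rule Lindelof[of ?F]) auto
    moreover have "\<Union>?F = \<Omega>"
    proof (intro equalityI subsetI)
      fix x assume "x \<in> \<Omega>"
      then obtain p q where "cbox p q \<subseteq> \<Omega>" "x \<in> box p q"
        by (rule open_contains_cbox[OF \<open>open \<Omega>\<close>])
      then show "x \<in> \<Union>?F" by blast
    qed (use box_subset_cbox in fast)
    ultimately show thesis by (intro that[of \<D>]) auto
  qed
  have "AE x in lebesgue. \<forall>X\<in>\<D>. x \<in> X \<longrightarrow> g x = 0"
    using \<D> on_box by (intro AE_ball_countable') blast
  then have "AE x in lebesgue. x \<in> \<Omega> \<longrightarrow> g x = 0"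
    by eventually_elim (use \<D>(3) in blast)
  then show ?thesis using \<open>open \<Omega>\<close> by (subst AE_restrict_space_iff) auto
qed

section \<open>Linearity of the operator almost everywhere\<close>

lemma test_function_compact_support:
  assumes "\<phi> \<in> test_functions \<Omega>"
  obtains C where "compact C" "C \<subseteq> \<Omega>" "\<And>x. x \<notin> C \<Longrightarrow> \<phi> x = 0"
    "\<And>x i. x \<notin> C \<Longrightarrow> partial_deriv i \<phi> x = 0"
proof -
  let ?C = "closure {x. \<phi> x \<noteq> 0}"
  have C: "compact ?C" "?C \<subseteq> \<Omega>" using assms unfolding test_functions_def by blast+
  have zero: "\<phi> x = 0" if "x \<notin> ?C" for x
    using that closure_subset[of "{x. \<phi> x \<noteq> 0}"] by blast
  have "partial_deriv i \<phi> x = 0" if x: "x \<notin> ?C" for x i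
  proof -
    have "((\<lambda>y. 0 :: real) has_derivative (\<lambda>h. 0)) (at x)" by simp
    then have "(\<phi> has_derivative (\<lambda>h. 0)) (at x)"
    proof (rule has_derivative_transform_within_open)
      show "open (- ?C)" by (simp only: open_Compl closed_closure)
      show "x \<in> - ?C" using x by simp
      show "0 = \<phi> y" if "y \<in> - ?C" for y using that zero[of y] by simp
    qed
    then show ?thesis by (simp add: partial_deriv_eq)
  qed
  with C zero show thesis by (intro that[of ?C])
qed

lemma test_function_continuous:
  assumes "\<phi> \<in> test_functions \<Omega>"
  shows "continuous_on UNIV \<phi>" "continuous_on UNIV (partial_deriv i \<phi>)"
proof -
  have "Ck 0 \<phi>" "Ck (Suc 0) \<phi>" using assms unfolding test_functions_def by blast+
  then show "continuous_on UNIV \<phi>" "continuous_on UNIV (partial_deriv i \<phi>)" by auto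
qed

lemma integrable_Lp_loc_1_mult_test:
  assumes "g \<in> Lp_loc 1 \<Omega>" "open \<Omega>" "\<phi> \<in> test_functions \<Omega>"
  shows "integrable (lebesgue_on \<Omega>) (\<lambda>x. g x * \<phi> x)"
    "integrable (lebesgue_on \<Omega>) (\<lambda>x. g x * partial_deriv i \<phi> x)"
proof -
  obtain C where "compact C" "C \<subseteq> \<Omega>" "\<And>x. x \<notin> C \<Longrightarrow> \<phi> x = 0"
    "\<And>x i. x \<notin> C \<Longrightarrow> partial_deriv i \<phi> x = 0"
    using test_function_compact_support[OF assms(3)] by blast
  then show "integrable (lebesgue_on \<Omega>) (\<lambda>x. g x * \<phi> x)"
    "integrable (lebesgue_on \<Omega>) (\<lambda>x. g x * partial_deriv i \<phi> x)"
    using integrable_Lp_loc_1_mult[OF assms(1,2)] test_function_continuous[OF assms(3)] by auto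
qed

lemma has_weak_partial_lincomb:
  assumes "open \<Omega>" and u: "has_weak_partial \<Omega> i u g" and v: "has_weak_partial \<Omega> i v h"
  shows "has_weak_partial \<Omega> i (\<lambda>x. s * u x + t * v x) (\<lambda>x. s * g x + t * h x)"
  unfolding has_weak_partial_def
proof (intro conjI ballI)
  have L1: "u \<in> Lp_loc 1 \<Omega>" "g \<in> Lp_loc 1 \<Omega>" "v \<in> Lp_loc 1 \<Omega>" "h \<in> Lp_loc 1 \<Omega>"
    using u v by (auto simp: has_weak_partial_def)
  then show "(\<lambda>x. s * u x + t * v x) \<in> Lp_loc 1 \<Omega>" "(\<lambda>x. s * g x + t * h x) \<in> Lp_loc 1 \<Omega>"
    by - (intro Lp_loc_1_lincomb; assumption)+
  fix \<phi> assume \<phi>: "\<phi> \<in> test_functions \<Omega>"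
  note int = L1[THEN integrable_Lp_loc_1_mult_test(1), OF \<open>open \<Omega>\<close> \<phi>]
    L1[THEN integrable_Lp_loc_1_mult_test(2), OF \<open>open \<Omega>\<close> \<phi>]
  show "(\<integral>x. (s * u x + t * v x) * partial_deriv i \<phi> x \<partial>lebesgue_on \<Omega>)
      = - (\<integral>x. (s * g x + t * h x) * \<phi> x \<partial>lebesgue_on \<Omega>)"
    using int u v \<phi>
    by (simp add: distrib_right mult.assoc Bochner_Integration.integral_add has_weak_partial_def)
qed

lemma has_weak_partial_cong_AE:
  assumes "open \<Omega>" and u: "has_weak_partial \<Omega> i u g"
    and u': "u' \<in> Lp_loc 1 \<Omega>" and ae: "AE x in lebesgue_on \<Omega>. u x = u' x"
  shows "has_weak_partial \<Omega> i u' g"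
  unfolding has_weak_partial_def
proof (intro conjI ballI)
  have L1: "u \<in> Lp_loc 1 \<Omega>" using u by (auto simp: has_weak_partial_def)
  show "u' \<in> Lp_loc 1 \<Omega>" "g \<in> Lp_loc 1 \<Omega>" using u u' by (auto simp: has_weak_partial_def)
  fix \<phi> assume \<phi>: "\<phi> \<in> test_functions \<Omega>"
  have "(\<integral>x. u' x * partial_deriv i \<phi> x \<partial>lebesgue_on \<Omega>) = (\<integral>x. u x * partial_deriv i \<phi> x \<partial>lebesgue_on \<Omega>)"
  proof (rule integral_cong_AE)
    show "AE x in lebesgue_on \<Omega>. u' x * partial_deriv i \<phi> x = u x * partial_deriv i \<phi> x"
      using ae by eventually_elim simp
  qed (use integrable_Lp_loc_1_mult_test(2)[OF _ \<open>open \<Omega>\<close> \<phi>] u' L1 in auto)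
  then show "(\<integral>x. u' x * partial_deriv i \<phi> x \<partial>lebesgue_on \<Omega>) = - (\<integral>x. g x * \<phi> x \<partial>lebesgue_on \<Omega>)"
    using u \<phi> by (simp add: has_weak_partial_def)
qed

text \<open>
  The difference of two weak derivatives of \<open>u\<close> is a weak derivative of \<open>0\<close>, hence weakly zero.
\<close>

lemma has_weak_partial_unique:
  assumes "open \<Omega>" and g: "has_weak_partial \<Omega> i u g" and h: "has_weak_partial \<Omega> i u h"
  shows "AE x in lebesgue_on \<Omega>. g x = h x"
proof -
  have zero: "has_weak_partial \<Omega> i (\<lambda>x. 1 * u x + (-1) * u x) (\<lambda>x. 1 * g x + (-1) * h x)"
    using assms by (rule has_weak_partial_lincomb)
  have "AE x in lebesgue_on \<Omega>. 1 * g x + (-1) * h x = 0"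
  proof (rule AE_eq_0_if_weakly_zero[OF _ \<open>open \<Omega>\<close>])
    show "(\<lambda>x. 1 * g x + (-1) * h x) \<in> Lp_loc 1 \<Omega>"
      using zero unfolding has_weak_partial_def by blast
    fix \<phi> assume "\<phi> \<in> test_functions \<Omega>"
    with zero have "(\<integral>x. (1 * u x + (-1) * u x) * partial_deriv i \<phi> x \<partial>lebesgue_on \<Omega>)
        = - (\<integral>x. (1 * g x + (-1) * h x) * \<phi> x \<partial>lebesgue_on \<Omega>)"
      unfolding has_weak_partial_def by blast
    then show "(\<integral>x. (1 * g x + (-1) * h x) * \<phi> x \<partial>lebesgue_on \<Omega>) = 0" by simp
  qed
  then show ?thesis by eventually_elim simp
qed

lemma weak_partial_works: "has_weak_partial \<Omega> i u g \<Longrightarrow> has_weak_partial \<Omega> i u (weak_partial \<Omega> i u)"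
  unfolding weak_partial_def by (rule someI[where P="has_weak_partial \<Omega> i u"])

text \<open>
  The function \<open>w\<close> is only required to agree with the linear combination almost everywhere because
  this is all that is known about first-order weak derivatives when the rule is applied to them.
\<close>

lemma weak_partial_lincomb:
  assumes "open \<Omega>" and u: "has_weak_partial \<Omega> i u g" and v: "has_weak_partial \<Omega> i v h"
    and w: "w \<in> Lp_loc 1 \<Omega>" "AE x in lebesgue_on \<Omega>. w x = s * u x + t * v x"
  shows "has_weak_partial \<Omega> i w (weak_partial \<Omega> i w)"
    and "AE x in lebesgue_on \<Omega>.
      weak_partial \<Omega> i w x = s * weak_partial \<Omega> i u x + t * weak_partial \<Omega> i v x"
proof -
  have "has_weak_partial \<Omega> i (\<lambda>x. s * u x + t * v x)
      (\<lambda>x. s * weak_partial \<Omega> i u x + t * weak_partial \<Omega> i v x)"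
    by (intro has_weak_partial_lincomb \<open>open \<Omega>\<close> weak_partial_works[OF u] weak_partial_works[OF v])
  then have *: "has_weak_partial \<Omega> i w (\<lambda>x. s * weak_partial \<Omega> i u x + t * weak_partial \<Omega> i v x)"
    by (rule has_weak_partial_cong_AE[OF \<open>open \<Omega>\<close> _ w(1)])
       (use w(2) in eventually_elim, simp)
  then show "has_weak_partial \<Omega> i w (weak_partial \<Omega> i w)" by (rule weak_partial_works)
  then show "AE x in lebesgue_on \<Omega>.
      weak_partial \<Omega> i w x = s * weak_partial \<Omega> i u x + t * weak_partial \<Omega> i v x"
    using * by (rule has_weak_partial_unique[OF \<open>open \<Omega>\<close>])
qed

text \<open>
  Expressed with the chosen versions \<open>weak_partial\<close>, since these are what \<open>elliptic_op\<close> is built from.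
\<close>

definition twice_weakly_diff :: "(real^'n::finite) set \<Rightarrow> (real^'n \<Rightarrow> real) \<Rightarrow> bool" where
  "twice_weakly_diff \<Omega> u \<longleftrightarrow> (\<forall>i. has_weak_partial \<Omega> i u (weak_partial \<Omega> i u) \<and>
     (\<forall>j. has_weak_partial \<Omega> j (weak_partial \<Omega> i u) (weak_partial \<Omega> j (weak_partial \<Omega> i u))))"

text \<open>
  Membership in \<open>W2p_loc\<close> provides second weak derivatives of some version \<open>g\<close> of the first ones. The
  version chosen by \<open>weak_partial\<close> agrees with \<open>g\<close> almost everywhere and has the same weak derivatives.
\<close>

lemma W2p_loc_imp_twice_weakly_diff:
  assumes "open \<Omega>" "u \<in> W2p_loc p \<Omega>"
  shows "twice_weakly_diff \<Omega> u"
  unfolding twice_weakly_diff_def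
proof (intro allI conjI)
  fix i j
  obtain g h where gh: "has_weak_partial \<Omega> i u g" "has_weak_partial \<Omega> j g h"
    using assms(2) unfolding W2p_loc_def by blast
  show i: "has_weak_partial \<Omega> i u (weak_partial \<Omega> i u)" by (rule weak_partial_works[OF gh(1)])
  have "has_weak_partial \<Omega> j (weak_partial \<Omega> i u) h"
  proof (rule has_weak_partial_cong_AE[OF assms(1) gh(2)])
    show "weak_partial \<Omega> i u \<in> Lp_loc 1 \<Omega>" using i by (simp add: has_weak_partial_def)
    show "AE x in lebesgue_on \<Omega>. g x = weak_partial \<Omega> i u x"
      by (rule has_weak_partial_unique[OF assms(1) gh(1) i])
  qed
  then show "has_weak_partial \<Omega> j (weak_partial \<Omega> i u) (weak_partial \<Omega> j (weak_partial \<Omega> i u))"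
    by (rule weak_partial_works)
qed

lemma twice_weakly_diff_lincomb:
  fixes \<Omega> :: "(real^'n::finite) set" and s t :: real
  assumes "open \<Omega>" and u: "twice_weakly_diff \<Omega> u" and v: "twice_weakly_diff \<Omega> v"
  defines "w \<equiv> \<lambda>x. s * u x + t * v x"
  shows "twice_weakly_diff \<Omega> w"
    and "AE x in lebesgue_on \<Omega>. elliptic_op \<Omega> a b c w x
           = s * elliptic_op \<Omega> a b c u x + t * elliptic_op \<Omega> a b c v x"
proof -
  have w1: "has_weak_partial \<Omega> i w (weak_partial \<Omega> i w)"
    and ae1: "AE x in lebesgue_on \<Omega>.
      weak_partial \<Omega> i w x = s * weak_partial \<Omega> i u x + t * weak_partial \<Omega> i v x" for i
  proof -
    have uv: "has_weak_partial \<Omega> i u (weak_partial \<Omega> i u)" "has_weak_partial \<Omega> i v (weak_partial \<Omega> i v)"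
      using u v by (auto simp: twice_weakly_diff_def)
    then have "w \<in> Lp_loc 1 \<Omega>"
      unfolding w_def by (intro Lp_loc_1_lincomb) (auto simp: has_weak_partial_def)
    note * = weak_partial_lincomb[OF \<open>open \<Omega>\<close> uv this, of s t]
    show "has_weak_partial \<Omega> i w (weak_partial \<Omega> i w)" by (rule *(1)) (simp add: w_def)
    show "AE x in lebesgue_on \<Omega>.
      weak_partial \<Omega> i w x = s * weak_partial \<Omega> i u x + t * weak_partial \<Omega> i v x"
      by (rule *(2)) (simp add: w_def)
  qed
  let ?H = "\<lambda>u i j. weak_partial \<Omega> j (weak_partial \<Omega> i u)"
  have w2: "has_weak_partial \<Omega> j (weak_partial \<Omega> i w) (?H w i j)"
    and ae2: "AE x in lebesgue_on \<Omega>. ?H w i j x = s * ?H u i j x + t * ?H v i j x" for i j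
  proof -
    have uv: "has_weak_partial \<Omega> j (weak_partial \<Omega> i u) (?H u i j)"
      "has_weak_partial \<Omega> j (weak_partial \<Omega> i v) (?H v i j)"
      using u v by (auto simp: twice_weakly_diff_def)
    have "weak_partial \<Omega> i w \<in> Lp_loc 1 \<Omega>" using w1 by (auto simp: has_weak_partial_def)
    note * = weak_partial_lincomb[OF \<open>open \<Omega>\<close> uv this ae1]
    show "has_weak_partial \<Omega> j (weak_partial \<Omega> i w) (?H w i j)" by (rule *(1))
    show "AE x in lebesgue_on \<Omega>. ?H w i j x = s * ?H u i j x + t * ?H v i j x" by (rule *(2))
  qed
  show "twice_weakly_diff \<Omega> w" unfolding twice_weakly_diff_def using w1 w2 by blast
  have "AE x in lebesgue_on \<Omega>. \<forall>i\<in>UNIV.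
      weak_partial \<Omega> i w x = s * weak_partial \<Omega> i u x + t * weak_partial \<Omega> i v x"
    by (intro AE_finite_allI ae1) simp
  moreover have "AE x in lebesgue_on \<Omega>. \<forall>i\<in>UNIV. \<forall>j\<in>UNIV.
      ?H w i j x = s * ?H u i j x + t * ?H v i j x"
    by (intro AE_finite_allI ae2) simp_all
  ultimately show "AE x in lebesgue_on \<Omega>. elliptic_op \<Omega> a b c w x
           = s * elliptic_op \<Omega> a b c u x + t * elliptic_op \<Omega> a b c v x"
  proof eventually_elim
    case (elim x)
    have G: "weak_gradient \<Omega> w x = s *\<^sub>R weak_gradient \<Omega> u x + t *\<^sub>R weak_gradient \<Omega> v x"
      using elim by (simp add: weak_gradient_def vec_eq_iff)
    have T: "trace (a x ** weak_hessian \<Omega> w x)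
        = s * trace (a x ** weak_hessian \<Omega> u x) + t * trace (a x ** weak_hessian \<Omega> v x)"
      using elim by (simp add: trace_def matrix_matrix_mult_def weak_hessian_def
          sum_distrib_left sum.distrib algebra_simps)
    then show ?case
      unfolding elliptic_op_def G T by (simp add: w_def inner_add_right algebra_simps)
  qed
qed

section \<open>Semicontinuous envelopes\<close>

text \<open>
  For \<open>e > 0\<close> a real number \<open>m\<close> can be placed so that \<open>u < m + e/2\<close> and \<open>v > m - e/2\<close> near \<open>x\<close>. The
  finiteness conditions exclude that both envelopes are \<open>\<infinity>\<close> or both are \<open>-\<infinity>\<close>, where the
  difference is not controlled.
\<close>

lemma usc_env_diff_le_0:
  assumes "U \<subseteq> D" and le: "usc_env D u x \<le> lsc_env D v x"
    and fin: "usc_env D u x \<noteq> \<infinity>" "lsc_env D v x \<noteq> -\<infinity>"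
  shows "usc_env U (\<lambda>y. u y - v y) x \<le> 0"
proof (rule ereal_le_epsilon2)
  fix e :: real assume e: "e > 0"
  obtain m where m: "usc_env D u x < ereal (m + e/2)" "ereal (m - e/2) < lsc_env D v x"
  proof (cases "usc_env D u x")
    case (real r)
    show thesis
    proof (rule that[of r])
      show "usc_env D u x < ereal (r + e/2)" using real e by simp
      have "ereal (r - e/2) < usc_env D u x" using real e by simp
      then show "ereal (r - e/2) < lsc_env D v x" using le by (rule less_le_trans)
    qed
  next
    case MInf
    then show thesis
    proof (cases "lsc_env D v x")
      case (real r)
      show thesis by (rule that[of r]) (use real MInf e in auto)
    qed (use that[of 0] fin in auto)
  qed (use fin in simp)
  obtain r1 where r1: "r1 > 0" "(SUP y\<in>D \<inter> ball x r1. ereal (u y)) < ereal (m + e/2)"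
    using m(1) unfolding usc_env_def INF_less_iff by auto
  obtain r2 where r2: "r2 > 0" "ereal (m - e/2) < (INF y\<in>D \<inter> ball x r2. ereal (v y))"
    using m(2) unfolding lsc_env_def less_SUP_iff by auto
  have "(SUP y\<in>U \<inter> ball x (min r1 r2). ereal (u y - v y)) \<le> ereal e"
  proof (rule SUP_least)
    fix y assume y: "y \<in> U \<inter> ball x (min r1 r2)"
    have "ereal (u y) \<le> (SUP y\<in>D \<inter> ball x r1. ereal (u y))"
      using y \<open>U \<subseteq> D\<close> by (intro SUP_upper) auto
    then have "ereal (u y) < ereal (m + e/2)" using r1(2) by (rule le_less_trans)
    moreover have "(INF y\<in>D \<inter> ball x r2. ereal (v y)) \<le> ereal (v y)"
      using y \<open>U \<subseteq> D\<close> by (intro INF_lower) auto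
    then have "ereal (m - e/2) < ereal (v y)" using r2(2) by (rule less_le_trans[rotated])
    ultimately show "ereal (u y - v y) \<le> ereal e" by simp
  qed
  then have "usc_env U (\<lambda>y. u y - v y) x \<le> ereal e"
    unfolding usc_env_def using r1 r2 by (intro INF_lower2[of "min r1 r2"]) auto
  then show "usc_env U (\<lambda>y. u y - v y) x \<le> 0 + ereal e" by simp
qed

lemma usc_env_le_continuous:
  assumes "continuous_on D u" "x \<in> D"
  shows "usc_env D u x \<le> ereal (u x)"
proof (rule ereal_le_epsilon2)
  fix e :: real assume "e > 0"
  then obtain r where r: "r > 0" "\<And>y. y \<in> D \<Longrightarrow> dist y x < r \<Longrightarrow> dist (u y) (u x) < e"
    using assms unfolding continuous_on_iff by blast
  have "(SUP y\<in>D \<inter> ball x r. ereal (u y)) \<le> ereal (u x) + ereal e"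
    by (rule SUP_least) (use r(2) in \<open>force simp: dist_real_def dist_commute\<close>)
  then show "usc_env D u x \<le> ereal (u x) + ereal e"
    unfolding usc_env_def using r(1) by (intro INF_lower2[of r]) auto
qed

lemma lsc_env_uminus: "lsc_env D (\<lambda>y. - u y) x = - usc_env D u x"
  unfolding usc_env_def lsc_env_def
  unfolding uminus_ereal.simps(1)[symmetric] ereal_INF_uminus_eq ereal_SUP_uminus_eq ..

lemma lsc_env_ge_continuous:
  assumes "continuous_on D u" "x \<in> D"
  shows "ereal (u x) \<le> lsc_env D u x"
proof -
  have "continuous_on D (\<lambda>y. - u y)" using assms(1) by (rule continuous_on_minus)
  from usc_env_le_continuous[OF this assms(2)]
  have "- (- ereal (u x)) \<le> - usc_env D (\<lambda>y. - u y) x"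
    unfolding ereal_minus_le_minus by simp
  also have "\<dots> = lsc_env D (\<lambda>y. - (- u y)) x" by (rule lsc_env_uminus[symmetric])
  finally show ?thesis by simp
qed

lemma lsc_env_le_usc_env:
  assumes "x \<in> closure D"
  shows "lsc_env D u x \<le> usc_env D u x"
  unfolding usc_env_def lsc_env_def
proof (intro SUP_least INF_greatest)
  fix r s :: real assume "r \<in> {0<..}" "s \<in> {0<..}"
  then obtain y where "y \<in> D" "dist y x < min r s"
    using assms unfolding closure_approachable by (metis greaterThan_iff min_less_iff_conj)
  then have "y \<in> D \<inter> ball x r" "y \<in> D \<inter> ball x s" by (auto simp: dist_commute)
  then show "(INF y\<in>D \<inter> ball x r. ereal (u y)) \<le> (SUP y\<in>D \<inter> ball x s. ereal (u y))"
    by (rule order_trans[OF INF_lower SUP_upper])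
qed

section \<open>Comparison for the obstacle problem\<close>

text \<open>
  The maximum principle is applied to \<open>u - v\<close> on the set \<open>U\<close> where \<open>u\<close> exceeds \<open>v\<close>; its conclusion
  \<open>u \<le> v\<close> on \<open>U\<close> says that \<open>U\<close> is empty.
\<close>

lemma obstacle_comparison:
  fixes \<Omega> \<Sigma> :: "(real^'n::finite) set"
  assumes "open \<Omega>" and K: "K \<subseteq> {w \<in> W2p_loc p \<Omega>. continuous_on \<Omega> w}"
    and cone: "fun_convex_cone K"
    and wmp: "\<And>U. open U \<Longrightarrow> U \<subseteq> \<Omega> \<Longrightarrow> weak_max_principle \<Omega> a b c \<Sigma> K U"
    and u: "u \<in> K" and v: "(\<lambda>x. - v x) \<in> K"
    and sol: "obstacle_solution \<Omega> a b c f \<psi> u"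
    and super: "obstacle_supersolution \<Omega> a b c f \<psi> v"
    and bdry: "\<And>x. x \<in> frontier \<Omega> - closure \<Sigma> \<Longrightarrow>
      usc_env \<Omega> u x \<le> lsc_env \<Omega> v x \<and> usc_env \<Omega> u x \<noteq> \<infinity> \<and> lsc_env \<Omega> v x \<noteq> -\<infinity>"
    and x: "x \<in> \<Omega>"
  shows "u x \<le> v x"
proof -
  define w where "w = (\<lambda>x. 1 * u x + (-1) * v x)"
  define U where "U = {x \<in> \<Omega>. v x < u x}"
  have "(\<lambda>x. 1 * u x + 1 * (- v x)) \<in> K"
    using cone[unfolded fun_convex_cone_def, rule_format, OF u v, of 1 1] by simp
  then have wK: "w \<in> K" by (simp add: w_def)
  have cont_u: "continuous_on \<Omega> u" and cont_v: "continuous_on \<Omega> v"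
    using K u v continuous_on_minus[of \<Omega> "\<lambda>x. - v x"] by auto
  have "open (\<Omega> \<inter> (\<lambda>x. u x - v x) -` {0<..})"
    using cont_u cont_v \<open>open \<Omega>\<close> by (intro continuous_open_preimage continuous_intros) auto
  also have "\<Omega> \<inter> (\<lambda>x. u x - v x) -` {0<..} = U" by (auto simp: U_def)
  finally have "open U" .
  have "U \<subseteq> \<Omega>" by (auto simp: U_def)
  have tu: "twice_weakly_diff \<Omega> u" and tmv: "twice_weakly_diff \<Omega> (\<lambda>x. - v x)"
    using W2p_loc_imp_twice_weakly_diff[OF \<open>open \<Omega>\<close>] K u v by blast+
  \<comment> \<open>Only \<open>- v\<close> is known to belong to the Sobolev space.\<close>
  have "twice_weakly_diff \<Omega> (\<lambda>x. (-1) * (- v x) + 0 * u x)"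
    by (rule twice_weakly_diff_lincomb(1)[OF \<open>open \<Omega>\<close> tmv tu])
  then have tv: "twice_weakly_diff \<Omega> v" by simp
  have "AE x in lebesgue_on \<Omega>. elliptic_op \<Omega> a b c w x
      = 1 * elliptic_op \<Omega> a b c u x + (-1) * elliptic_op \<Omega> a b c v x"
    unfolding w_def by (rule twice_weakly_diff_lincomb(2)[OF \<open>open \<Omega>\<close> tu tv])
  \<comment> \<open>On \<open>U\<close> the solution lies strictly above \<open>v\<close> and hence above the obstacle, so it solves the
    equation with right-hand side \<open>f\<close> there.\<close>
  with sol super have "AE x in lebesgue_on \<Omega>. x \<in> U \<longrightarrow> elliptic_op \<Omega> a b c w x \<le> 0"
    unfolding obstacle_solution_def obstacle_supersolution_def
    by eventually_elim (auto simp: U_def min_def split: if_splits)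
  then have Aw: "AE x in lebesgue_on U. elliptic_op \<Omega> a b c w x \<le> 0"
    using \<open>open \<Omega>\<close> \<open>open U\<close> \<open>U \<subseteq> \<Omega>\<close>
    by (auto simp: AE_restrict_space_iff elim: eventually_mono)
  have "usc_env U w y \<le> 0" if y: "y \<in> frontier U - closure \<Sigma>" for y
  proof -
    have "usc_env \<Omega> u y \<le> lsc_env \<Omega> v y \<and> usc_env \<Omega> u y \<noteq> \<infinity> \<and> lsc_env \<Omega> v y \<noteq> -\<infinity>"
      \<comment> \<open>At a point of \<open>\<Omega>\<close>, continuity and \<open>y \<notin> U\<close> give the inequality between the envelopes; a point
        outside \<open>\<Omega>\<close> lies on its frontier, where it is assumed.\<close>
    proof (cases "y \<in> \<Omega>")
      case True
      have "y \<notin> U" using y \<open>open U\<close> by (simp add: frontier_def interior_open)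
      then have "ereal (u y) \<le> ereal (v y)" using True by (simp add: U_def)
      moreover have "usc_env \<Omega> u y \<le> ereal (u y)" "ereal (v y) \<le> lsc_env \<Omega> v y"
        using True cont_u cont_v usc_env_le_continuous lsc_env_ge_continuous by blast+
      ultimately have "usc_env \<Omega> u y \<le> lsc_env \<Omega> v y" by (meson order_trans)
      then show ?thesis
        using \<open>usc_env \<Omega> u y \<le> ereal (u y)\<close> \<open>ereal (v y) \<le> lsc_env \<Omega> v y\<close> by auto
    next
      case False
      have "y \<in> closure \<Omega>" using y closure_mono[OF \<open>U \<subseteq> \<Omega>\<close>] by (auto simp: frontier_def)
      then show ?thesis using False y \<open>open \<Omega>\<close> by (intro bdry) (auto simp: frontier_def interior_open)
    qed
    then have "usc_env U (\<lambda>y. u y - v y) y \<le> 0"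
      using usc_env_diff_le_0[OF \<open>U \<subseteq> \<Omega>\<close>] by blast
    then show ?thesis by (simp add: w_def)
  qed
  then have "\<forall>x\<in>U. w x \<le> 0"
    using wmp[OF \<open>open U\<close> \<open>U \<subseteq> \<Omega>\<close>] wK Aw unfolding weak_max_principle_def by blast
  then show ?thesis using x by (force simp: U_def w_def)
qed

theorem proposition3p2:
  fixes \<Omega> \<Sigma> :: "(real^'n::finite) set"
    and a :: "real^'n \<Rightarrow> real^'n^'n"
    and b :: "real^'n \<Rightarrow> real^'n"
    and c f \<psi> u v :: "real^'n \<Rightarrow> real"
    and K :: "(real^'n \<Rightarrow> real) set"
  assumes "open \<Omega>"
    and "a \<in> borel_measurable (lebesgue_on \<Omega>)"
    and "b \<in> borel_measurable (lebesgue_on \<Omega>)"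
    and "c \<in> borel_measurable (lebesgue_on \<Omega>)"
    and "\<And>x. x \<in> \<Omega> \<Longrightarrow> nonneg_definite (a x)"
    and "K \<subseteq> {w \<in> W2p_loc CARD('n) \<Omega>. continuous_on \<Omega> w}"
    and "fun_convex_cone K"
    and "openin (top_of_set (frontier \<Omega>)) \<Sigma>"
    and "\<And>U. open U \<Longrightarrow> U \<subseteq> \<Omega> \<Longrightarrow> weak_max_principle \<Omega> a b c \<Sigma> K U"
    and "f \<in> Lp_loc CARD('n) \<Omega>"
    and "\<psi> \<in> Lp_loc CARD('n) \<Omega>"
    and "u \<in> K"
    and "(\<lambda>x. - v x) \<in> K"
    and "obstacle_solution \<Omega> a b c f \<psi> u"
  shows
    "(obstacle_supersolution \<Omega> a b c f \<psi> v \<and>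
      (\<forall>x\<in>frontier \<Omega> - closure \<Sigma>.
         usc_env \<Omega> u x \<le> lsc_env \<Omega> v x \<and> usc_env \<Omega> u x \<noteq> \<infinity> \<and> lsc_env \<Omega> v x \<noteq> -\<infinity>)
      \<longrightarrow> (\<forall>x\<in>\<Omega>. u x \<le> v x))
     \<and>
     (obstacle_solution \<Omega> a b c f \<psi> v \<and>
      (\<lambda>x. - u x) \<in> K \<and> v \<in> K \<and>
      (\<forall>x\<in>frontier \<Omega> - closure \<Sigma>.
         lsc_env \<Omega> v x = usc_env \<Omega> u x \<and> lsc_env \<Omega> u x = usc_env \<Omega> v x \<and>
         \<bar>usc_env \<Omega> u x\<bar> \<noteq> \<infinity>)
      \<longrightarrow> (\<forall>x\<in>\<Omega>. u x = v x))"
proof (intro conjI impI; elim conjE)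
  note compare = obstacle_comparison[OF assms(1,6,7,9)]
  note u = assms(12) and minus_v = assms(13) and sol_u = assms(14)
  assume super: "obstacle_supersolution \<Omega> a b c f \<psi> v"
    and bdry: "\<forall>x\<in>frontier \<Omega> - closure \<Sigma>.
      usc_env \<Omega> u x \<le> lsc_env \<Omega> v x \<and> usc_env \<Omega> u x \<noteq> \<infinity> \<and> lsc_env \<Omega> v x \<noteq> -\<infinity>"
  show "\<forall>x\<in>\<Omega>. u x \<le> v x"
    using compare[OF _ _ u minus_v sol_u super] bdry by auto
next
  note compare = obstacle_comparison[OF assms(1,6,7,9)]
  note u = assms(12) and minus_v = assms(13) and sol_u = assms(14)
  assume sol_v: "obstacle_solution \<Omega> a b c f \<psi> v"
    and minus_u: "(\<lambda>x. - u x) \<in> K" and v: "v \<in> K"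
    and bdry: "\<forall>x\<in>frontier \<Omega> - closure \<Sigma>.
         lsc_env \<Omega> v x = usc_env \<Omega> u x \<and> lsc_env \<Omega> u x = usc_env \<Omega> v x \<and>
         \<bar>usc_env \<Omega> u x\<bar> \<noteq> \<infinity>"
  have super: "obstacle_supersolution \<Omega> a b c f \<psi> u" "obstacle_supersolution \<Omega> a b c f \<psi> v"
    using sol_u sol_v unfolding obstacle_solution_def obstacle_supersolution_def by auto
  \<comment> \<open>The inequality between lower and upper envelopes closes the chain
    \<open>v\<^sup>* = u\<^sub>* \<le> u\<^sup>* = v\<^sub>* \<le> v\<^sup>*\<close>, so all four envelopes agree and are finite.\<close>
  have env: "usc_env \<Omega> u x \<le> lsc_env \<Omega> v x \<and> usc_env \<Omega> u x \<noteq> \<infinity> \<and> lsc_env \<Omega> v x \<noteq> -\<infinity>"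
    "usc_env \<Omega> v x \<le> lsc_env \<Omega> u x \<and> usc_env \<Omega> v x \<noteq> \<infinity> \<and> lsc_env \<Omega> u x \<noteq> -\<infinity>"
    if x: "x \<in> frontier \<Omega> - closure \<Sigma>" for x
  proof -
    have b: "lsc_env \<Omega> v x = usc_env \<Omega> u x" "lsc_env \<Omega> u x = usc_env \<Omega> v x"
      "\<bar>usc_env \<Omega> u x\<bar> \<noteq> \<infinity>"
      using bdry x by auto
    have "x \<in> closure \<Omega>" using x by (simp add: frontier_def)
    then have "lsc_env \<Omega> u x \<le> usc_env \<Omega> u x" "lsc_env \<Omega> v x \<le> usc_env \<Omega> v x"
      by (rule lsc_env_le_usc_env)+
    then show "usc_env \<Omega> u x \<le> lsc_env \<Omega> v x \<and> usc_env \<Omega> u x \<noteq> \<infinity> \<and> lsc_env \<Omega> v x \<noteq> -\<infinity>"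
      "usc_env \<Omega> v x \<le> lsc_env \<Omega> u x \<and> usc_env \<Omega> v x \<noteq> \<infinity> \<and> lsc_env \<Omega> u x \<noteq> -\<infinity>"
      using b by auto
  qed
  show "\<forall>x\<in>\<Omega>. u x = v x"
    using compare[OF _ _ u minus_v sol_u super(2) env(1)] compare[OF _ _ v minus_u sol_v super(1) env(2)]
    by (auto intro: antisym)
qed

end
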